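(* Let $G$ be a finite simple graph with $n$ vertices and edge set $E(G)$, and for a vertex $u$ let $d_u$ be its degree. For $k\ge 1$ let $S_k(G)$ denote the number of subgraphs of $G$ isomorphic to the star $K_{1,k}$. Then \[ \sum_{uv\in E(G)}\left(\frac{1}{d_u}+\frac{1}{d_v}\right)=S_1(G)+\sum_{i=1}^{n-1}(-1)^{i-1}S_i(G). \]
   Context: $K_{1,k}$ is the star graph with one center and $k$ leaves; $S_k(G)$ counts its (not necessarily induced) copies in $G$, so $S_1(G)$ is the number of edges. *)

theory Defs
  imports Complex_Main "Graph_Theory.Kuratowski"
begin

text \<open>
  A finite simple graph is a \<open>pair_graph\<close>: a finite, loop-free, symmetric set of arcs
  (ordered pairs). An undirected edge \<open>uv\<close> thus appears as the two arcs \<open>(u, v)\<close> and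
  \<open>(v, u)\<close>; sums over edges must range over the unordered pairs below, not over \<open>parcs\<close>.
\<close>

definition edges :: "'a pair_pre_digraph \<Rightarrow> 'a set set" where
  "edges G = {{u, v} | u v. (u, v) \<in> parcs G}"

text \<open>Since the arcs are symmetric, the out-degree is the number of edges at a vertex.\<close>

abbreviation degree :: "'a pair_pre_digraph \<Rightarrow> 'a \<Rightarrow> nat" where
  "degree G v \<equiv> out_degree (with_proj G) v"

text \<open>
  The predicate \<open>complete_bipartite_digraph 1 k\<close> describes exactly the (symmetric) graphs
  isomorphic to the star with \<open>k\<close> leaves, so every subgraph \<open>H\<close> counted here is again an
  undirected graph. Subgraphs are counted as such: neither a centre nor an ordering of the
  leaves is marked, so for \<open>k = 1\<close> every edge is counted once.
\<close>

definition star_count :: "nat \<Rightarrow> 'a pair_pre_digraph \<Rightarrow> nat" where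
  "star_count k G =
     card {H :: 'a pair_pre_digraph.
             subgraph (with_proj H) (with_proj G) \<and>
             complete_bipartite_digraph 1 k (with_proj H)}"

end

theory Submission
  imports Defs
begin

text \<open>
  Each vertex \<open>v\<close> contributes \<open>1 / d\<^sub>v\<close> for each of its \<open>d\<^sub>v\<close> edges, so the left-hand
  side is the number of non-isolated vertices. For \<open>k \<ge> 2\<close> a star determines its centre, so
  \<open>S\<^sub>k\<close> is the sum of \<open>d\<^sub>v choose k\<close> over all \<open>v\<close>; for \<open>k = 1\<close> that sum counts
  every edge twice, which the extra summand \<open>S\<^sub>1\<close> compensates. Exchanging summations on the
  right, each non-isolated vertex contributes
  \<open>(d choose 1) - (d choose 2) + \<dots> = 1 - (1 - 1)^d = 1\<close>.
\<close>

text \<open>Since \<open>d choose i\<close> vanishes for \<open>i > d\<close>, the upper limit may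
  be any \<open>m \<ge> d\<close>. One limit thus serves all degrees at once, as the exchange of
  summations requires.\<close>

lemma alternating_choose_sum:
  assumes "d \<le> m"
  shows "(\<Sum>i = 1..m. (-1) ^ (i - 1) * real (d choose i)) = (if d = 0 then 0 else 1)"
proof (cases "d = 0")
  case True
  then show ?thesis by (auto intro!: sum.neutral)
next
  case False
  have "0 = (\<Sum>i\<le>d. (-1) ^ i * real (d choose i))"
    using choose_alternating_sum[of d, where 'a = real] False by simp
  also have "\<dots> = (\<Sum>i\<le>m. (-1) ^ i * real (d choose i))"
    by (rule sum.mono_neutral_left) (use assms in auto)
  also have "\<dots> = 1 + (\<Sum>i = 1..m. (-1) ^ i * real (d choose i))"
    by (simp add: sum.atLeast_Suc_atMost[of 0 m] flip: atLeast0AtMost)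
  also have "(\<Sum>i = 1..m. (-1) ^ i * real (d choose i)) =
      - (\<Sum>i = 1..m. (-1) ^ (i - 1) * real (d choose i))"
    unfolding sum_negf[symmetric]
  proof (rule sum.cong)
    fix i assume "i \<in> {1..m}"
    then obtain j where "i = Suc j" by (cases i) auto
    then show "(-1) ^ i * real (d choose i) = - ((-1) ^ (i - 1) * real (d choose i))" by simp
  qed simp
  finally show ?thesis using False by simp
qed

definition star :: "'a \<Rightarrow> 'a set \<Rightarrow> 'a pair_pre_digraph" where
  "star v L = \<lparr>pverts = insert v L, parcs = {v} \<times> L \<union> L \<times> {v}\<rparr>"

definition neighbours :: "'a pair_pre_digraph \<Rightarrow> 'a \<Rightarrow> 'a set" where
  "neighbours G v = {w. (v, w) \<in> parcs G}"

definition stars :: "nat \<Rightarrow> 'a pair_pre_digraph \<Rightarrow> 'a pair_pre_digraph set" where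
  "stars k G = {H. subgraph (with_proj H) (with_proj G) \<and>
                   complete_bipartite_digraph 1 k (with_proj H)}"

lemma star_count_eq_card_stars: "star_count k G = card (stars k G)"
  by (simp add: star_count_def stars_def)

text \<open>If the centres differed, each arc from \<open>v\<close> to a leaf in \<open>L\<close>
  would have to end in \<open>w\<close>, leaving room for one leaf only. A single edge really is a
  star in two ways, hence the bound on \<open>card L\<close>.\<close>

lemma star_eq_iff:
  assumes "card L \<ge> 2" "v \<notin> L" "w \<notin> M"
  shows "star v L = star w M \<longleftrightarrow> v = w \<and> L = M"
proof
  assume eq: "star v L = star w M"
  then have arcs: "{v} \<times> L \<union> L \<times> {v} = {w} \<times> M \<union> M \<times> {w}"
    and verts: "insert v L = insert w M"
    by (simp_all add: star_def)
  have "v = w"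
  proof (rule ccontr)
    assume "v \<noteq> w"
    have "L \<subseteq> {w}"
    proof
      fix x assume "x \<in> L"
      then have "(v, x) \<in> {w} \<times> M \<union> M \<times> {w}" unfolding arcs[symmetric] by blast
      with \<open>v \<noteq> w\<close> show "x \<in> {w}" by blast
    qed
    then have "card L \<le> 1" using card_mono[of "{w}" L] by simp
    with assms show False by simp
  qed
  with verts assms show "v = w \<and> L = M" by auto
qed simp

context pair_graph
begin

lemma finite_neighbours: "finite (neighbours G v)"
proof (rule finite_subset)
  show "neighbours G v \<subseteq> pverts G" by (auto simp: neighbours_def dest: in_arcsD2)
qed (rule pair_finite_verts)

lemma not_neighbour_self: "v \<notin> neighbours G v"
  by (auto simp: neighbours_def dest: no_loops')

lemma degree_eq_card_neighbours: "degree G v = card (neighbours G v)"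
proof -
  have "out_arcs (with_proj G) v = Pair v ` neighbours G v"
    by (auto simp: neighbours_def)
  then show ?thesis by (simp add: out_degree_def card_image inj_on_def)
qed

lemma degree_le: "v \<in> pverts G \<Longrightarrow> degree G v \<le> card (pverts G) - 1"
  using card_mono[of "pverts G - {v}" "neighbours G v"] not_neighbour_self[of v]
  by (auto simp: degree_eq_card_neighbours pair_finite_verts neighbours_def dest: in_arcsD2)

lemma finite_edges: "finite (edges G)"
proof (rule finite_subset)
  show "edges G \<subseteq> Pow (pverts G)" by (auto simp: edges_def dest: in_arcsD1 in_arcsD2)
qed (simp add: pair_finite_verts)

lemma card_edges_at: "card {e \<in> edges G. v \<in> e} = degree G v"
proof -
  have "{e \<in> edges G. v \<in> e} = (\<lambda>w. {v, w}) ` neighbours G v"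
    by (auto simp: edges_def neighbours_def insert_commute intro: arcs_symmetric)
  moreover have "inj_on (\<lambda>w. {v, w}) (neighbours G v)"
    by (auto simp: inj_on_def doubleton_eq_iff)
  ultimately show ?thesis by (simp add: card_image degree_eq_card_neighbours)
qed

text \<open>Double counting of incident pairs of a vertex and an edge. The constant 1 gives the
  handshake identity, the reciprocal degree the left-hand side of the theorem.\<close>

lemma sum_edges_eq_sum_verts:
  fixes f :: "'a \<Rightarrow> real"
  shows "(\<Sum>e\<in>edges G. \<Sum>u\<in>e. f u) = (\<Sum>v\<in>pverts G. real (degree G v) * f v)"
proof -
  have "(\<Sum>e\<in>edges G. \<Sum>u\<in>e. f u) = (\<Sum>e\<in>edges G. \<Sum>u\<in>{u \<in> pverts G. u \<in> e}. f u)"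
    by (intro sum.cong) (auto simp: edges_def dest: in_arcsD1 in_arcsD2)
  also have "\<dots> = (\<Sum>v\<in>pverts G. \<Sum>e\<in>{e \<in> edges G. v \<in> e}. f v)"
    by (rule sum.swap_restrict) (simp_all add: finite_edges pair_finite_verts)
  finally show ?thesis by (simp add: card_edges_at)
qed

lemma card_edge:
  assumes "e \<in> edges G"
  shows "card e = 2"
  using assms by (auto simp: edges_def card_2_iff dest: no_loops')

lemma handshake: "(\<Sum>v\<in>pverts G. real (degree G v)) = 2 * real (card (edges G))"
  using sum_edges_eq_sum_verts[of "\<lambda>_. 1"] by (simp add: card_edge)

text \<open>Parametrises stars by centre and leaf set. This is onto for every \<open>k\<close>;
  injectivity is a separate matter, as it needs \<open>k \<ge> 2\<close>.\<close>

lemma stars_eq_image: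
  "stars k G = (\<lambda>(v, L). star v L) ` (SIGMA v:pverts G. {L. L \<subseteq> neighbours G v \<and> card L = k})"
  (is "_ = ?f ` ?S")
proof (intro equalityI subsetI)
  fix H assume "H \<in> stars k G"
  then obtain U V where H: "pverts H \<subseteq> pverts G" "parcs H \<subseteq> parcs G" "card U = 1"
      "card V = k" "pverts H = U \<union> V" "parcs H = U \<times> V \<union> V \<times> U"
    by (auto simp: stars_def subgraph_def complete_bipartite_digraph_pair_def)
  then obtain v where v: "U = {v}" by (auto simp: card_1_singleton_iff)
  with H have "H = star v V" "v \<in> pverts G" "V \<subseteq> neighbours G v"
    by (auto simp: star_def neighbours_def)
  with H show "H \<in> ?f ` ?S" by force
next
  fix H assume "H \<in> ?f ` ?S"
  then obtain v L where H: "H = star v L" "v \<in> pverts G" "L \<subseteq> neighbours G v" "card L = k"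
    by auto
  have "v \<notin> L" using H not_neighbour_self by blast
  moreover have "finite L" using H finite_neighbours finite_subset by blast
  ultimately have K: "complete_bipartite_digraph 1 k (with_proj H)"
    unfolding complete_bipartite_digraph_pair_def using H
    by (intro conjI exI[of _ "{v}"] exI[of _ L]) (auto simp: star_def)
  \<comment> \<open>Supplies the well-formedness of \<open>H\<close> that \<open>subgraph\<close>
    demands besides the two inclusions.\<close>
  then interpret H: pair_graph H by (rule pair_graphI_complete_bipartite)
  have "pverts H \<subseteq> pverts G" "parcs H \<subseteq> parcs G"
    using H by (auto simp: star_def neighbours_def dest: in_arcsD2 intro: arcs_symmetric)
  with K show "H \<in> stars k G"
    using wf_digraph H.wf_digraph by (auto simp: stars_def subgraph_def)
qed

lemma star_count_eq_sum_choose: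
  assumes "k \<ge> 2"
  shows "star_count k G = (\<Sum>v\<in>pverts G. degree G v choose k)"
proof -
  let ?S = "SIGMA v:pverts G. {L. L \<subseteq> neighbours G v \<and> card L = k}"
  have "inj_on (\<lambda>(v, L). star v L) ?S"
  proof (rule inj_onI, clarify)
    fix v L w M
    assume "L \<subseteq> neighbours G v" "M \<subseteq> neighbours G w" "k = card L" "star v L = star w M"
    with assms star_eq_iff[of L v w M] not_neighbour_self show "v = w \<and> L = M" by blast
  qed
  then have "star_count k G = card ?S"
    by (simp add: star_count_eq_card_stars stars_eq_image card_image)
  also have "\<dots> = (\<Sum>v\<in>pverts G. card {L. L \<subseteq> neighbours G v \<and> card L = k})"
    by (rule card_SigmaI) (simp_all add: pair_finite_verts finite_neighbours)
  finally show ?thesis by (simp add: n_subsets finite_neighbours degree_eq_card_neighbours)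
qed

lemma star_count_1: "star_count 1 G = card (edges G)"
proof -
  \<comment> \<open>The complete graph on \<open>e\<close>: a description of a one-leaf star that
    singles out no centre. It is injective because \<open>e\<close> is its vertex set.\<close>
  let ?h = "\<lambda>e. \<lparr>pverts = e, parcs = {(a, b). a \<in> e \<and> b \<in> e \<and> a \<noteq> b}\<rparr>"
  have h: "star v {w} = ?h {v, w}" if "(v, w) \<in> parcs G" for v w
    using no_loops'[OF that] by (auto simp: star_def)
  have "stars 1 G = ?h ` edges G"
  proof (intro equalityI subsetI)
    fix H assume "H \<in> stars 1 G"
    then obtain v w where "H = star v {w}" "(v, w) \<in> parcs G"
      by (auto simp: stars_eq_image neighbours_def card_1_singleton_iff)
    with h[of v w] show "H \<in> ?h ` edges G" by (auto simp: edges_def)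
  next
    fix H assume "H \<in> ?h ` edges G"
    then obtain v w where vw: "H = ?h {v, w}" "(v, w) \<in> parcs G"
      unfolding edges_def by blast
    then have "(v, {w}) \<in> (SIGMA v:pverts G. {L. L \<subseteq> neighbours G v \<and> card L = 1})"
      by (auto simp: neighbours_def dest: in_arcsD1)
    then show "H \<in> stars 1 G"
      unfolding stars_eq_image using h[of v w] vw by (intro image_eqI[of _ _ "(v, {w})"]) simp_all
  qed
  moreover have "inj_on ?h (edges G)" by (auto simp: inj_on_def)
  ultimately show ?thesis by (simp add: star_count_eq_card_stars card_image)
qed

text \<open>For \<open>k = 1\<close> this is the handshake identity: either end of an edge can be
  its centre, so \<open>star_count 1 G\<close> occurs twice.\<close>

lemma sum_choose_degree:
  assumes "k \<ge> 1"
  shows "(\<Sum>v\<in>pverts G. real (degree G v choose k)) =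
    real (star_count k G) + (if k = 1 then real (star_count 1 G) else 0)"
proof (cases "k = 1")
  case True
  then show ?thesis using handshake star_count_1 by simp
next
  case False
  with assms show ?thesis by (simp add: star_count_eq_sum_choose)
qed

end

theorem theorem3:
  fixes G :: "'a pair_pre_digraph" and n :: nat
  assumes "pair_graph G"
    and "n = card (pverts G)"
  shows "(\<Sum>e\<in>edges G. \<Sum>u\<in>e. 1 / real (degree G u)) =
         real (star_count 1 G) + (\<Sum>i = 1..n - 1. (-1) ^ (i - 1) * real (star_count i G))"
proof -
  interpret pair_graph G by fact
  \<comment> \<open>With at most one vertex the range \<open>1..n - 1\<close> is empty and yields no
    correction term for \<open>i = 1\<close>; the separate summand must then be zero.\<close>
  have star_count_1_eq_0: "star_count 1 G = 0" if "n - 1 = 0"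
    unfolding star_count_1 using handshake degree_le that assms(2) by simp
  have "(\<Sum>e\<in>edges G. \<Sum>u\<in>e. 1 / real (degree G u)) =
      (\<Sum>v\<in>pverts G. if degree G v = 0 then 0 else 1)"
    \<comment> \<open>At an isolated vertex the product is \<open>0 * (1 / 0) = 0\<close>, so
      exactly the other vertices contribute 1.\<close>
    unfolding sum_edges_eq_sum_verts by (rule sum.cong) auto
  also have "\<dots> = (\<Sum>v\<in>pverts G. \<Sum>i = 1..n - 1. (-1) ^ (i - 1) * real (degree G v choose i))"
    by (rule sum.cong[OF refl], rule alternating_choose_sum[symmetric])
       (unfold assms(2), rule degree_le)
  also have "\<dots> = (\<Sum>i = 1..n - 1. (-1) ^ (i - 1) * (\<Sum>v\<in>pverts G. real (degree G v choose i)))"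
    unfolding sum_distrib_left by (rule sum.swap)
  also have "\<dots> = (\<Sum>i = 1..n - 1. (-1) ^ (i - 1) * real (star_count i G) +
      (if i = 1 then real (star_count 1 G) else 0))"
    by (rule sum.cong) (simp_all add: sum_choose_degree algebra_simps)
  also have "\<dots> = (\<Sum>i = 1..n - 1. (-1) ^ (i - 1) * real (star_count i G)) +
      (if 1 \<le> n - 1 then real (star_count 1 G) else 0)"
    by (simp add: sum.distrib)
  finally show ?thesis using star_count_1_eq_0 by (auto simp: not_le)
qed

end
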